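(* The monoid ${\cal M}_{\sf end}^{\sf P}={\cal RM}^{\sf P}/\!\equiv_{\sf end}$ is congruence-simple.
   Context: Let $A=\{0,1\}$, and let $A^*$ be the set of all finite words over $A$ (including the empty word), $|x|$ the length of $x$. "Function" means partial function; ${\sf Dom}(f)$ is the domain of $f$. A right ideal is a set $R\subseteq A^*$ with $RA^*=R$. A function $f:A^*\to A^*$ is polynomially balanced iff there is a polynomial $p$ such that $|f(x)|\le p(|x|)$ and $|x|\le p(|f(x)|)$ for all $x\in{\sf Dom}(f)$. ${\sf fP}$ is the monoid of all polynomially balanced partial functions $A^*\to A^*$ computable by deterministic Turing machines in polynomial time. A right-ideal morphism is a partial function $h:A^*\to A^*$ such that ${\sf Dom}(h)$ is a right ideal and $h(xw)=h(x)\,w$ for all $x\in{\sf Dom}(h)$, $w\in A^*$. ${\cal RM}^{\sf P}$ is the monoid (under composition) of all $f\in{\sf fP}$ that are right-ideal morphisms. For $L_1,L_2\subseteq A^*$: $L_1\equiv_{\sf end}L_2$ iff $L_1A^*$ and $L_2A^*$ intersect (i.e., meet in a nonempty set) the same right ideals of $A^*$. Two right-ideal morphisms $f_1,f_2$ satisfy $f_1\equiv_{\sf end}f_2$ iff ${\sf Dom}(f_1)\equiv_{\sf end}{\sf Dom}(f_2)$ and $f_1,f_2$ agree on ${\sf Dom}(f_1)\cap{\sf Dom}(f_2)$. This is a congruence on ${\cal RM}^{\sf P}$, and ${\cal M}_{\sf end}^{\sf P}$ denotes the quotient monoid. A monoid $M$ is congruence-simple iff $M$ is non-trivial and the only congruences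 on $M$ are the equality relation and the one-class congruence. *)

theory Defs
  imports "HOL-Algebra.Group" "HOL-Computational_Algebra.Polynomial"
begin

text \<open>The alphabet \<open>{0,1}\<close> is the type bool (0 is False, 1 is True); partial functions on
  words are maps, composed by \<open>f \<circ>\<^sub>m g\<close> (first \<open>g\<close>, then \<open>f\<close>).\<close>

type_synonym word = "bool list"

definition ideal_gen :: "word set \<Rightarrow> word set" where
  "ideal_gen L = {x @ w | x w. x \<in> L}"

definition right_ideal :: "word set \<Rightarrow> bool" where
  "right_ideal R \<longleftrightarrow> ideal_gen R = R"

definition end_equiv :: "word set \<Rightarrow> word set \<Rightarrow> bool" where
  "end_equiv L1 L2 \<longleftrightarrow>
     (\<forall>R. right_ideal R \<longrightarrow> (ideal_gen L1 \<inter> R \<noteq> {} \<longleftrightarrow> ideal_gen L2 \<inter> R \<noteq> {}))"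

definition right_ideal_morphism :: "(word \<rightharpoonup> word) \<Rightarrow> bool" where
  "right_ideal_morphism h \<longleftrightarrow> right_ideal (dom h) \<and>
     (\<forall>x y w. h x = Some y \<longrightarrow> h (x @ w) = Some (y @ w))"

definition fun_end_equiv :: "(word \<rightharpoonup> word) \<Rightarrow> (word \<rightharpoonup> word) \<Rightarrow> bool" where
  "fun_end_equiv f1 f2 \<longleftrightarrow>
     end_equiv (dom f1) (dom f2) \<and> (\<forall>x \<in> dom f1 \<inter> dom f2. f1 x = f2 x)"

text \<open>States are the numbers below \<open>tm_nstates\<close> and tape symbols the numbers below \<open>tm_nsyms\<close>,
  with blank = 0, and the input letters 0 and 1 represented by the symbols 1 and 2. Given a state
  and the list of scanned symbols (one per tape), \<open>tm_delta\<close> yields the next state and, for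
  each tape, the symbol to write and a head movement in \<open>{-1, 0, 1}\<close>.

  Tapes are two-way infinite and are stored relative to their head: the scanned cell always has
  index 0, and moving the head shifts the tape.\<close>

type_synonym tape = "int \<Rightarrow> nat"

record tm =
  tm_ntapes :: nat
  tm_nsyms :: nat
  tm_nstates :: nat
  tm_start :: nat
  tm_accept :: nat
  tm_reject :: nat
  tm_delta :: "nat \<Rightarrow> nat list \<Rightarrow> nat \<times> (nat \<times> int) list"

definition wf_tm :: "tm \<Rightarrow> bool" where
  "wf_tm M \<longleftrightarrow>
     tm_ntapes M \<ge> 1 \<and> tm_nsyms M \<ge> 3 \<and>
     tm_start M < tm_nstates M \<and> tm_accept M < tm_nstates M \<and> tm_reject M < tm_nstates M \<and>
     tm_accept M \<noteq> tm_reject M \<and>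
     (\<forall>q ss. q < tm_nstates M \<and> length ss = tm_ntapes M \<and> set ss \<subseteq> {..<tm_nsyms M} \<longrightarrow>
        fst (tm_delta M q ss) < tm_nstates M \<and>
        length (snd (tm_delta M q ss)) = tm_ntapes M \<and>
        set (snd (tm_delta M q ss)) \<subseteq> {..<tm_nsyms M} \<times> {-1, 0, 1})"

definition tape_act :: "nat \<times> int \<Rightarrow> tape \<Rightarrow> tape" where
  "tape_act a t = (\<lambda>i. (t(0 := fst a)) (i + snd a))"

definition tm_step :: "tm \<Rightarrow> nat \<times> tape list \<Rightarrow> nat \<times> tape list" where
  "tm_step M c = (let (q, ts) = c in
     if q = tm_accept M \<or> q = tm_reject M then c
     else let (q', as) = tm_delta M q (map (\<lambda>t. t 0) ts) in (q', map2 tape_act as ts))"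

text \<open>The tape carrying \<open>w\<close> and otherwise blank, with the head on the first letter of \<open>w\<close>.\<close>

definition word_tape :: "word \<Rightarrow> tape" where
  "word_tape w = (\<lambda>i. if 0 \<le> i \<and> i < int (length w) then (if w ! nat i then 2 else 1) else 0)"

definition tm_init :: "tm \<Rightarrow> word \<Rightarrow> nat \<times> tape list" where
  "tm_init M x = (tm_start M, word_tape x # replicate (tm_ntapes M - 1) (word_tape []))"

text \<open>The input is on the first tape and the output on the last one (these coincide for a
  one-tape machine). A machine computing a partial function halts within its time bound on every
  input, accepting exactly the inputs in the domain; on acceptance the output tape is the word
  tape of the value, while the other tapes are unrestricted.\<close>

definition tm_computes_in_time :: "tm \<Rightarrow> (word \<rightharpoonup> word) \<Rightarrow> (nat \<Rightarrow> nat) \<Rightarrow> bool" where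
  "tm_computes_in_time M f T \<longleftrightarrow>
     (\<forall>x. let (q, ts) = (tm_step M ^^ T (length x)) (tm_init M x) in
        case f x of
          None \<Rightarrow> q = tm_reject M
        | Some y \<Rightarrow> q = tm_accept M \<and> last ts = word_tape y)"

definition polytime_computable :: "(word \<rightharpoonup> word) \<Rightarrow> bool" where
  "polytime_computable f \<longleftrightarrow>
     (\<exists>M (p :: nat poly). wf_tm M \<and> tm_computes_in_time M f (poly p))"

definition poly_balanced :: "(word \<rightharpoonup> word) \<Rightarrow> bool" where
  "poly_balanced f \<longleftrightarrow>
     (\<exists>p :: nat poly. \<forall>x y. f x = Some y \<longrightarrow>
        length y \<le> poly p (length x) \<and> length x \<le> poly p (length y))"

definition fP :: "(word \<rightharpoonup> word) set" where
  "fP = {f. poly_balanced f \<and> polytime_computable f}"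

definition RMP :: "(word \<rightharpoonup> word) monoid" where
  "RMP = \<lparr>carrier = {f \<in> fP. right_ideal_morphism f}, monoid.mult = (\<circ>\<^sub>m), one = Some\<rparr>"

definition RMP_end_rel :: "((word \<rightharpoonup> word) \<times> (word \<rightharpoonup> word)) set" where
  "RMP_end_rel = {(f, g). f \<in> carrier RMP \<and> g \<in> carrier RMP \<and> fun_end_equiv f g}"

definition monoid_congruence :: "('a, 'm) monoid_scheme \<Rightarrow> ('a \<times> 'a) set \<Rightarrow> bool" where
  "monoid_congruence M r \<longleftrightarrow> equiv (carrier M) r \<and>
     (\<forall>a b c d. (a, b) \<in> r \<and> (c, d) \<in> r \<longrightarrow> (a \<otimes>\<^bsub>M\<^esub> c, b \<otimes>\<^bsub>M\<^esub> d) \<in> r)"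

text \<open>The product of two classes is the class of the product of any representatives; if \<open>r\<close> is
  a congruence, the union below is a union of equal classes.\<close>

definition quotient_monoid :: "('a, 'm) monoid_scheme \<Rightarrow> ('a \<times> 'a) set \<Rightarrow> 'a set monoid" where
  "quotient_monoid M r =
     \<lparr>carrier = carrier M // r,
      monoid.mult = (\<lambda>X Y. \<Union>x\<in>X. \<Union>y\<in>Y. r `` {x \<otimes>\<^bsub>M\<^esub> y}),
      one = r `` {\<one>\<^bsub>M\<^esub>}\<rparr>"

definition M_end_P :: "(word \<rightharpoonup> word) set monoid" where
  "M_end_P = quotient_monoid RMP RMP_end_rel"

definition congruence_simple :: "('a, 'm) monoid_scheme \<Rightarrow> bool" where
  "congruence_simple M \<longleftrightarrow> monoid M \<and> carrier M \<noteq> {\<one>\<^bsub>M\<^esub>} \<and>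
     (\<forall>r. monoid_congruence M r \<longrightarrow> r = Id_on (carrier M) \<or> r = carrier M \<times> carrier M)"

end

theory Submission
  imports Defs
begin

text \<open>
  Why the monoid is congruence-simple. For a word \<open>u\<close> let \<open>prepend u\<close> be the total map
  \<open>w \<mapsto> uw\<close> and \<open>strip u\<close> its partial inverse \<open>uw \<mapsto> w\<close>. If \<open>f x = y\<close> for a right-ideal morphism
  \<open>f\<close>, then \<open>strip y \<circ> f \<circ> prepend x\<close> is the identity; so a congruence that relates
  a nonempty morphism to the empty one relates \<open>1\<close> to the zero element and has only one class.

  It remains to produce such a pair from any two related morphisms \<open>f\<close>, \<open>g\<close> that are not
  \<open>\<equiv>\<^sub>e\<^sub>n\<^sub>d\<close>-equivalent. If their domains are inequivalent, some \<open>x\<close> in the domain of one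
  has no extension in the domain of the other, and composing with \<open>prepend x\<close> empties exactly one of
  them. If they differ at a common argument \<open>x\<close>, say \<open>f x = y \<noteq> z = g x\<close>, then composing with
  \<open>prepend x\<close> on the right and \<open>strip y\<close> on the left turns \<open>f\<close> into the identity and \<open>g\<close> into the
  empty map, unless \<open>y\<close> and \<open>z\<close> are comparable for the prefix order. In that case, up to
  exchanging the two, \<open>z = yv\<close> with \<open>v\<close> nonempty, the second map becomes \<open>prepend v\<close>, and a
  conjugation with a letter other than the first one of \<open>v\<close> separates it from the identity.

  That the structure is a monoid at all, and that the maps above belong to it, are facts about
  Turing machines. The input and output conventions make them light: the output tape of one
  machine can serve directly as the input tape of the next (\<open>seq_tm\<close>), whence closure under
  composition (\<open>tm_computes_seq_tm\<close>), and \<open>prepend u\<close>, \<open>strip u\<close> are compositions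
  of their one-letter instances, for which one-tape machines with at most two steps suffice.
\<close>

section \<open>Quotient monoids and their congruences\<close>

lemma quotient_mult_class:
  assumes "monoid_congruence M r" "a \<in> carrier M" "b \<in> carrier M"
  shows "(r `` {a}) \<otimes>\<^bsub>quotient_monoid M r\<^esub> (r `` {b}) = r `` {a \<otimes>\<^bsub>M\<^esub> b}"
proof -
  have eq: "equiv (carrier M) r"
    and cong: "\<And>a b c d. (a, b) \<in> r \<Longrightarrow> (c, d) \<in> r \<Longrightarrow> (a \<otimes>\<^bsub>M\<^esub> c, b \<otimes>\<^bsub>M\<^esub> d) \<in> r"
    using assms(1) unfolding monoid_congruence_def by blast+
  have "r `` {x \<otimes>\<^bsub>M\<^esub> y} = r `` {a \<otimes>\<^bsub>M\<^esub> b}" if "x \<in> r `` {a}" "y \<in> r `` {b}" for x y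
    using equiv_class_eq[OF eq cong] that by blast
  moreover have "a \<in> r `` {a}" "b \<in> r `` {b}"
    using equiv_class_self[OF eq] assms(2,3) by auto
  ultimately have "(\<Union>x\<in>r `` {a}. \<Union>y\<in>r `` {b}. r `` {x \<otimes>\<^bsub>M\<^esub> y}) = r `` {a \<otimes>\<^bsub>M\<^esub> b}"
    by blast
  then show ?thesis by (simp add: quotient_monoid_def)
qed

lemma carrier_quotient_monoid:
  "carrier (quotient_monoid M r) = {r `` {a} | a. a \<in> carrier M}"
  by (auto simp: quotient_monoid_def quotient_def)

lemma monoid_quotient_monoid:
  assumes "monoid M" "monoid_congruence M r"
  shows "monoid (quotient_monoid M r)"
proof -
  interpret monoid M by fact
  note mult = quotient_mult_class[OF assms(2)]
  have one: "\<one>\<^bsub>quotient_monoid M r\<^esub> = r `` {\<one>\<^bsub>M\<^esub>}"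
    by (simp add: quotient_monoid_def)
  have rep: "\<exists>a. a \<in> carrier M \<and> X = r `` {a}" if "X \<in> carrier (quotient_monoid M r)" for X
    using that by (auto simp: carrier_quotient_monoid)
  have cls: "r `` {a} \<in> carrier (quotient_monoid M r)" if "a \<in> carrier M" for a
    using that by (auto simp: carrier_quotient_monoid)
  show ?thesis
  proof (rule monoidI)
    fix X Y assume "X \<in> carrier (quotient_monoid M r)" "Y \<in> carrier (quotient_monoid M r)"
    from this[THEN rep] obtain a b
      where "X = r `` {a}" "a \<in> carrier M" "Y = r `` {b}" "b \<in> carrier M" by auto
    then show "X \<otimes>\<^bsub>quotient_monoid M r\<^esub> Y \<in> carrier (quotient_monoid M r)"
      by (simp add: mult cls)
  next
    show "\<one>\<^bsub>quotient_monoid M r\<^esub> \<in> carrier (quotient_monoid M r)"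
      by (simp add: one cls)
  next
    fix X Y Z
    assume "X \<in> carrier (quotient_monoid M r)" "Y \<in> carrier (quotient_monoid M r)"
      "Z \<in> carrier (quotient_monoid M r)"
    from this[THEN rep] obtain a b c where "X = r `` {a}" "a \<in> carrier M"
      "Y = r `` {b}" "b \<in> carrier M" "Z = r `` {c}" "c \<in> carrier M" by auto
    then show "X \<otimes>\<^bsub>quotient_monoid M r\<^esub> Y \<otimes>\<^bsub>quotient_monoid M r\<^esub> Z =
        X \<otimes>\<^bsub>quotient_monoid M r\<^esub> (Y \<otimes>\<^bsub>quotient_monoid M r\<^esub> Z)"
      by (simp add: mult m_assoc)
  next
    fix X assume "X \<in> carrier (quotient_monoid M r)"
    from this[THEN rep] obtain a where "X = r `` {a}" "a \<in> carrier M" by auto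
    then show "\<one>\<^bsub>quotient_monoid M r\<^esub> \<otimes>\<^bsub>quotient_monoid M r\<^esub> X = X"
      "X \<otimes>\<^bsub>quotient_monoid M r\<^esub> \<one>\<^bsub>quotient_monoid M r\<^esub> = X"
      by (simp_all add: one mult)
  qed
qed

text \<open>Congruences of a quotient correspond to congruences of the monoid above that contain the
  given one, by pulling back along the projection; thus simplicity can be tested upstairs.\<close>

lemma congruence_simple_quotient_monoid:
  assumes "monoid M" "monoid_congruence M r"
    and nontrivial: "z \<in> carrier M" "(z, \<one>\<^bsub>M\<^esub>) \<notin> r"
    and maximal: "\<And>s. monoid_congruence M s \<Longrightarrow> r \<subseteq> s \<Longrightarrow> s \<noteq> r \<Longrightarrow> s = carrier M \<times> carrier M"
  shows "congruence_simple (quotient_monoid M r)"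
proof -
  interpret monoid M by fact
  let ?Q = "quotient_monoid M r"
  have eq: "equiv (carrier M) r"
    using assms(2) unfolding monoid_congruence_def by blast
  have cls: "r `` {a} \<in> carrier ?Q" if "a \<in> carrier M" for a
    using that by (auto simp: carrier_quotient_monoid)
  have class_eq: "r `` {a} = r `` {b} \<longleftrightarrow> (a, b) \<in> r" if "a \<in> carrier M" "b \<in> carrier M" for a b
    using eq_equiv_class_iff[OF eq that] .
  have "r `` {z} \<noteq> \<one>\<^bsub>?Q\<^esub>"
    using class_eq nontrivial by (simp add: quotient_monoid_def)
  with cls[OF nontrivial(1)] have "carrier ?Q \<noteq> {\<one>\<^bsub>?Q\<^esub>}"
    by blast
  moreover have "t = Id_on (carrier ?Q) \<or> t = carrier ?Q \<times> carrier ?Q"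
    if t: "monoid_congruence ?Q t" for t
  proof -
    have teq: "equiv (carrier ?Q) t"
      and tcong: "\<And>a b c d. (a, b) \<in> t \<Longrightarrow> (c, d) \<in> t \<Longrightarrow> (a \<otimes>\<^bsub>?Q\<^esub> c, b \<otimes>\<^bsub>?Q\<^esub> d) \<in> t"
      using t unfolding monoid_congruence_def by blast+
    have trefl: "\<And>X. X \<in> carrier ?Q \<Longrightarrow> (X, X) \<in> t"
      and tsub: "t \<subseteq> carrier ?Q \<times> carrier ?Q"
      and tsym: "sym t" and ttrans: "trans t"
      using teq by (auto simp: equiv_def refl_on_def)
    define s where
      "s = {(a, b). a \<in> carrier M \<and> b \<in> carrier M \<and> (r `` {a}, r `` {b}) \<in> t}"
    have "equiv (carrier M) s"
    proof (rule equivI)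
      show "s \<subseteq> carrier M \<times> carrier M" by (auto simp: s_def)
      show "refl_on (carrier M) s" using cls trefl by (simp add: s_def refl_on_def)
      show "sym s" unfolding s_def using symD[OF tsym] by (intro symI) blast
      show "trans s" unfolding s_def using transD[OF ttrans] by (intro transI) blast
    qed
    moreover have "(a \<otimes>\<^bsub>M\<^esub> c, b \<otimes>\<^bsub>M\<^esub> d) \<in> s" if ab: "(a, b) \<in> s" and cd: "(c, d) \<in> s" for a b c d
    proof -
      have "(r `` {a}, r `` {b}) \<in> t" "(r `` {c}, r `` {d}) \<in> t"
        and "a \<in> carrier M" "b \<in> carrier M" "c \<in> carrier M" "d \<in> carrier M"
        using ab cd by (simp_all add: s_def)
      with tcong[OF this(1,2)] show ?thesis
        by (simp add: s_def quotient_mult_class[OF assms(2)])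
    qed
    ultimately have s: "monoid_congruence M s"
      unfolding monoid_congruence_def by blast
    have rsub: "r \<subseteq> carrier M \<times> carrier M"
      using eq by (simp add: equiv_def)
    have "r \<subseteq> s"
    proof
      fix p assume "p \<in> r"
      then obtain a b where p: "p = (a, b)" "(a, b) \<in> r" "a \<in> carrier M" "b \<in> carrier M"
        using rsub by auto
      with class_eq have "r `` {a} = r `` {b}" by blast
      with trefl[OF cls] p show "p \<in> s" by (simp add: s_def)
    qed
    show ?thesis
    proof (cases "s = r")
      case True
      have "t \<subseteq> Id_on (carrier ?Q)"
      proof
        fix p assume "p \<in> t"
        then obtain a b where p: "p = (r `` {a}, r `` {b})" "a \<in> carrier M" "b \<in> carrier M"
          using tsub by (auto simp: carrier_quotient_monoid)
        with \<open>p \<in> t\<close> have "(a, b) \<in> s" by (simp add: s_def)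
        with True class_eq[OF p(2,3)] have "r `` {a} = r `` {b}" by simp
        with p(1) cls[OF p(2)] show "p \<in> Id_on (carrier ?Q)" by (simp add: Id_on_iff)
      qed
      with trefl show ?thesis by auto
    next
      case False
      with maximal s \<open>r \<subseteq> s\<close> have "s = carrier M \<times> carrier M" by blast
      then have "carrier ?Q \<times> carrier ?Q \<subseteq> t"
        by (fastforce simp: s_def carrier_quotient_monoid)
      with tsub show ?thesis by blast
    qed
  qed
  ultimately show ?thesis
    using monoid_quotient_monoid[OF assms(1,2)] unfolding congruence_simple_def by blast
qed

section \<open>Right ideals and end-equivalence\<close>

lemma right_ideal_iff: "right_ideal R \<longleftrightarrow> (\<forall>x\<in>R. \<forall>w. x @ w \<in> R)"
proof
  assume "right_ideal R"
  then show "\<forall>x\<in>R. \<forall>w. x @ w \<in> R"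
    unfolding right_ideal_def ideal_gen_def by blast
next
  assume "\<forall>x\<in>R. \<forall>w. x @ w \<in> R"
  moreover have "x = x @ []" for x :: word by simp
  ultimately show "right_ideal R"
    unfolding right_ideal_def ideal_gen_def by blast
qed

lemma right_ideal_extensions: "right_ideal {x @ w | w. True}"
  unfolding right_ideal_iff by auto

text \<open>It suffices to test end-equivalence against the principal right ideals.\<close>

lemma end_equiv_iff:
  assumes "right_ideal D1" "right_ideal D2"
  shows "end_equiv D1 D2 \<longleftrightarrow>
    (\<forall>x\<in>D1. \<exists>w. x @ w \<in> D2) \<and> (\<forall>x\<in>D2. \<exists>w. x @ w \<in> D1)"
proof
  assume e: "end_equiv D1 D2"
  have meet: "D1 \<inter> {x @ w | w. True} \<noteq> {} \<longleftrightarrow> D2 \<inter> {x @ w | w. True} \<noteq> {}" for x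
    using e assms right_ideal_extensions unfolding end_equiv_def right_ideal_def by metis
  have self: "x \<in> {x @ w | w. True}" for x :: word
    by (auto intro: exI[of _ "[]"])
  show "(\<forall>x\<in>D1. \<exists>w. x @ w \<in> D2) \<and> (\<forall>x\<in>D2. \<exists>w. x @ w \<in> D1)"
    using meet self by blast
next
  assume e: "(\<forall>x\<in>D1. \<exists>w. x @ w \<in> D2) \<and> (\<forall>x\<in>D2. \<exists>w. x @ w \<in> D1)"
  have "D1 \<inter> R \<noteq> {} \<longleftrightarrow> D2 \<inter> R \<noteq> {}" if "right_ideal R" for R
    using that e unfolding right_ideal_iff by blast
  then show "end_equiv D1 D2"
    using assms unfolding end_equiv_def right_ideal_def by metis
qed

lemma right_ideal_morphism_append:
  "right_ideal_morphism h \<Longrightarrow> h x = Some y \<Longrightarrow> h (x @ w) = Some (y @ w)"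
  by (auto simp: right_ideal_morphism_def)

lemma right_ideal_morphism_iff:
  "right_ideal_morphism h \<longleftrightarrow> (\<forall>x y w. h x = Some y \<longrightarrow> h (x @ w) = Some (y @ w))"
proof
  assume h: "\<forall>x y w. h x = Some y \<longrightarrow> h (x @ w) = Some (y @ w)"
  then have "right_ideal (dom h)"
    unfolding right_ideal_iff by (metis domI domD)
  with h show "right_ideal_morphism h"
    by (simp add: right_ideal_morphism_def)
qed (simp add: right_ideal_morphism_def)

lemma right_ideal_morphism_comp:
  assumes "right_ideal_morphism f" "right_ideal_morphism g"
  shows "right_ideal_morphism (f \<circ>\<^sub>m g)"
  unfolding right_ideal_morphism_iff
proof (intro allI impI)
  fix x z w assume "(f \<circ>\<^sub>m g) x = Some z"
  then obtain y where "g x = Some y" "f y = Some z"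
    by (auto simp: map_comp_Some_iff)
  with assms have "g (x @ w) = Some (y @ w)" "f (y @ w) = Some (z @ w)"
    by (simp_all add: right_ideal_morphism_append)
  then show "(f \<circ>\<^sub>m g) (x @ w) = Some (z @ w)"
    by (simp add: map_comp_Some_iff)
qed

text \<open>Common domains do not compose well, whereas an extension of an extension is again an extension;
  transitivity and compatibility with composition are therefore proved from this form. That the maps
  agree on the whole common domain is recovered by cancelling the extension.\<close>

lemma fun_end_equiv_iff:
  assumes "right_ideal_morphism f" "right_ideal_morphism g"
  shows "fun_end_equiv f g \<longleftrightarrow>
    (\<forall>x y. f x = Some y \<longrightarrow> (\<exists>w. g (x @ w) = Some (y @ w))) \<and>
    (\<forall>x y. g x = Some y \<longrightarrow> (\<exists>w. f (x @ w) = Some (y @ w)))" (is "_ \<longleftrightarrow> ?E")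
proof -
  have ideals: "right_ideal (dom f)" "right_ideal (dom g)"
    using assms by (simp_all add: right_ideal_morphism_def)
  show ?thesis
  proof
    assume "fun_end_equiv f g"
    then have dom: "\<forall>x\<in>dom f. \<exists>w. x @ w \<in> dom g" "\<forall>x\<in>dom g. \<exists>w. x @ w \<in> dom f"
      and agree: "\<And>x. x \<in> dom f \<Longrightarrow> x \<in> dom g \<Longrightarrow> f x = g x"
      using end_equiv_iff[OF ideals] unfolding fun_end_equiv_def by blast+
    show ?E
    proof (intro conjI allI impI)
      fix x y assume "f x = Some y"
      moreover from this obtain w where "x @ w \<in> dom g" using dom by blast
      ultimately show "\<exists>w. g (x @ w) = Some (y @ w)"
        using agree[of "x @ w"] right_ideal_morphism_append[OF assms(1)] by (metis domI)
    next
      fix x y assume "g x = Some y"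
      moreover from this obtain w where "x @ w \<in> dom f" using dom by blast
      ultimately show "\<exists>w. f (x @ w) = Some (y @ w)"
        using agree[of "x @ w"] right_ideal_morphism_append[OF assms(2)] by (metis domI)
    qed
  next
    assume E: ?E
    have "end_equiv (dom f) (dom g)"
      using E unfolding end_equiv_iff[OF ideals] by blast
    moreover have "f x = g x" if "x \<in> dom f" "x \<in> dom g" for x
    proof -
      from that obtain y z where yz: "f x = Some y" "g x = Some z" by blast
      with E obtain w where "g (x @ w) = Some (y @ w)" by blast
      with yz right_ideal_morphism_append[OF assms(2) yz(2)] show ?thesis by simp
    qed
    ultimately show "fun_end_equiv f g"
      unfolding fun_end_equiv_def by blast
  qed
qed

lemma fun_end_equiv_refl: "fun_end_equiv f f"
  by (simp add: fun_end_equiv_def end_equiv_def)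

lemma fun_end_equiv_sym: "fun_end_equiv f g \<Longrightarrow> fun_end_equiv g f"
  by (auto simp: fun_end_equiv_def end_equiv_def)

lemma fun_end_equiv_trans:
  assumes "right_ideal_morphism f" "right_ideal_morphism g" "right_ideal_morphism h"
    and fg: "fun_end_equiv f g" and gh: "fun_end_equiv g h"
  shows "fun_end_equiv f h"
proof -
  have "\<exists>w. h (x @ w) = Some (y @ w)" if "f x = Some y" for x y
    using that fg gh unfolding fun_end_equiv_iff[OF assms(1,2)] fun_end_equiv_iff[OF assms(2,3)]
    by (metis append.assoc)
  moreover have "\<exists>w. f (x @ w) = Some (y @ w)" if "h x = Some y" for x y
    using that fg gh unfolding fun_end_equiv_iff[OF assms(1,2)] fun_end_equiv_iff[OF assms(2,3)]
    by (metis append.assoc)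
  ultimately show ?thesis
    unfolding fun_end_equiv_iff[OF assms(1,3)] by blast
qed

text \<open>One extension makes the inner maps agree and a further one the outer maps; the
  agreement of the inner maps survives the second extension.\<close>

lemma map_comp_extension:
  assumes "right_ideal_morphism g'"
    and f: "\<And>x y. f x = Some y \<Longrightarrow> \<exists>w. f' (x @ w) = Some (y @ w)"
    and g: "\<And>x y. g x = Some y \<Longrightarrow> \<exists>w. g' (x @ w) = Some (y @ w)"
    and "right_ideal_morphism f" and "(f \<circ>\<^sub>m g) x = Some z"
  shows "\<exists>w. (f' \<circ>\<^sub>m g') (x @ w) = Some (z @ w)"
proof -
  from assms(5) obtain y where y: "g x = Some y" "f y = Some z"
    by (auto simp: map_comp_Some_iff)
  with g obtain w where w: "g' (x @ w) = Some (y @ w)" by blast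
  from y(2) have "f (y @ w) = Some (z @ w)"
    using right_ideal_morphism_append[OF assms(4)] by blast
  with f obtain v where v: "f' ((y @ w) @ v) = Some ((z @ w) @ v)" by blast
  have "g' ((x @ w) @ v) = Some ((y @ w) @ v)"
    using right_ideal_morphism_append[OF assms(1) w] .
  with v have "(f' \<circ>\<^sub>m g') (x @ (w @ v)) = Some (z @ (w @ v))"
    by (simp add: map_comp_Some_iff)
  then show ?thesis ..
qed

lemma fun_end_equiv_comp:
  assumes m: "right_ideal_morphism f" "right_ideal_morphism f'"
      "right_ideal_morphism g" "right_ideal_morphism g'"
    and "fun_end_equiv f f'" "fun_end_equiv g g'"
  shows "fun_end_equiv (f \<circ>\<^sub>m g) (f' \<circ>\<^sub>m g')"
proof -
  note f = assms(5)[unfolded fun_end_equiv_iff[OF m(1,2)]]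
  note g = assms(6)[unfolded fun_end_equiv_iff[OF m(3,4)]]
  show ?thesis
    unfolding fun_end_equiv_iff[OF right_ideal_morphism_comp[OF m(1,3)]
        right_ideal_morphism_comp[OF m(2,4)]]
    using map_comp_extension[of g' f f' g, OF m(4) _ _ m(1)]
      map_comp_extension[of g f' f g', OF m(3) _ _ m(2)] f g by simp
qed

section \<open>Sequential composition of Turing machines\<close>

definition halted :: "tm \<Rightarrow> nat \<times> tape list \<Rightarrow> bool" where
  "halted M c \<longleftrightarrow> fst c = tm_accept M \<or> fst c = tm_reject M"

lemma tm_step_halted: "halted M c \<Longrightarrow> tm_step M c = c"
  by (cases c) (auto simp: halted_def tm_step_def)

lemma tm_run_halted: "halted M c \<Longrightarrow> (tm_step M ^^ n) c = c"
  by (induction n) (auto simp: tm_step_halted)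

lemma tm_run_after_halting:
  assumes "halted M ((tm_step M ^^ t) c)" "t \<le> n"
  shows "(tm_step M ^^ n) c = (tm_step M ^^ t) c"
proof -
  from assms(2) have "(tm_step M ^^ n) c = (tm_step M ^^ (n - t)) ((tm_step M ^^ t) c)"
    by (metis comp_apply funpow_add le_add_diff_inverse2)
  with tm_run_halted[OF assms(1)] show ?thesis by simp
qed

text \<open>In a run that meets this invariant every transition lies in the range where well-formedness
  constrains the transition function; a machine embedded in a larger one with more states and symbols
  is simulated faithfully only there.\<close>

definition valid_config :: "tm \<Rightarrow> nat \<times> tape list \<Rightarrow> bool" where
  "valid_config M c \<longleftrightarrow> fst c < tm_nstates M \<and> length (snd c) = tm_ntapes M \<and>
     (\<forall>t\<in>set (snd c). \<forall>i. t i < tm_nsyms M)"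

lemma valid_config_step:
  assumes "wf_tm M" "valid_config M c"
  shows "valid_config M (tm_step M c)"
proof (cases "halted M c")
  case True
  with assms show ?thesis by (simp add: tm_step_halted)
next
  case False
  obtain q ts where c: "c = (q, ts)" by (cases c)
  obtain q' as where d: "tm_delta M q (map (\<lambda>t. t 0) ts) = (q', as)" by fastforce
  have v: "q < tm_nstates M" "length ts = tm_ntapes M" "\<forall>t\<in>set ts. \<forall>i. t i < tm_nsyms M"
    using assms(2) by (auto simp: valid_config_def c)
  then have "q' < tm_nstates M" "length as = tm_ntapes M"
      "set as \<subseteq> {..<tm_nsyms M} \<times> {-1, 0, 1}"
    using assms(1) d unfolding wf_tm_def
    by (auto dest!: spec[of _ q] spec[of _ "map (\<lambda>t. t 0) ts"])
  moreover from this have "t i < tm_nsyms M" if t: "t \<in> set (map2 tape_act as ts)" for t i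
  proof -
    from t obtain a u where "t = tape_act a u" "(a, u) \<in> set (zip as ts)" by auto
    moreover from this(2) have "a \<in> set as" "u \<in> set ts"
      by (rule set_zip_leftD, rule set_zip_rightD)
    ultimately show ?thesis
      using v(3) \<open>set as \<subseteq> _\<close> by (auto simp: tape_act_def)
  qed
  ultimately show ?thesis
    using False v(2) d by (auto simp: c halted_def tm_step_def valid_config_def)
qed

lemma valid_config_run:
  assumes "wf_tm M" "valid_config M c"
  shows "valid_config M ((tm_step M ^^ n) c)"
  by (induction n) (auto simp: assms valid_config_step)

lemma word_tape_less: "word_tape w i < 3"
  by (simp add: word_tape_def)

lemma valid_config_init: "wf_tm M \<Longrightarrow> valid_config M (tm_init M x)"
  using order.strict_trans2[OF word_tape_less, of "tm_nsyms M"]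
  by (auto simp: valid_config_def tm_init_def wf_tm_def)

definition stay :: "nat list \<Rightarrow> (nat \<times> int) list" where
  "stay ss = map (\<lambda>s. (s, 0)) ss"

lemma length_stay [simp]: "length (stay ss) = length ss"
  by (simp add: stay_def)

lemma set_stay_subset: "set ss \<subseteq> {..<k} \<Longrightarrow> set (stay ss) \<subseteq> {..<k} \<times> {-1, 0, 1}"
  by (auto simp: stay_def)

lemma map2_tape_act_stay [simp]: "map2 tape_act (stay (map (\<lambda>t. t 0) ts)) ts = ts"
  by (induction ts) (auto simp: stay_def tape_act_def)

text \<open>The last tape of \<open>M\<close> is also the first tape of \<open>N\<close>: on acceptance by \<open>M\<close> it carries exactly
  what \<open>N\<close> expects, with its head in the right place, so handing over takes a single step. The
  states of \<open>N\<close> are shifted by the number of states of \<open>M\<close>. A symbol foreign to the running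
  machine never occurs on its tapes, but the transition function has to be well-formed there too,
  and rejects.\<close>

definition seq_tm :: "tm \<Rightarrow> tm \<Rightarrow> tm" where
  "seq_tm M N = \<lparr>
     tm_ntapes = tm_ntapes M + (tm_ntapes N - 1),
     tm_nsyms = max (tm_nsyms M) (tm_nsyms N),
     tm_nstates = tm_nstates M + tm_nstates N,
     tm_start = tm_start M,
     tm_accept = tm_nstates M + tm_accept N,
     tm_reject = tm_nstates M + tm_reject N,
     tm_delta = (\<lambda>q ss.
       if q = tm_accept M then (tm_nstates M + tm_start N, stay ss)
       else if q = tm_reject M then (tm_nstates M + tm_reject N, stay ss)
       else if q < tm_nstates M \<and> set (take (tm_ntapes M) ss) \<subseteq> {..<tm_nsyms M} then
         (let (q', as) = tm_delta M q (take (tm_ntapes M) ss)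
          in (q', as @ stay (drop (tm_ntapes M) ss)))
       else if q \<ge> tm_nstates M \<and> set (drop (tm_ntapes M - 1) ss) \<subseteq> {..<tm_nsyms N} then
         (let (q', as) = tm_delta N (q - tm_nstates M) (drop (tm_ntapes M - 1) ss)
          in (tm_nstates M + q', stay (take (tm_ntapes M - 1) ss) @ as))
       else (tm_nstates M + tm_reject N, stay ss))\<rparr>"

lemma seq_tm_simps [simp]:
  "tm_ntapes (seq_tm M N) = tm_ntapes M + (tm_ntapes N - 1)"
  "tm_nsyms (seq_tm M N) = max (tm_nsyms M) (tm_nsyms N)"
  "tm_nstates (seq_tm M N) = tm_nstates M + tm_nstates N"
  "tm_start (seq_tm M N) = tm_start M"
  "tm_accept (seq_tm M N) = tm_nstates M + tm_accept N"
  "tm_reject (seq_tm M N) = tm_nstates M + tm_reject N"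
  by (simp_all add: seq_tm_def)

lemma wf_tmD:
  assumes "wf_tm M" "q < tm_nstates M" "length ss = tm_ntapes M" "set ss \<subseteq> {..<tm_nsyms M}"
    and "tm_delta M q ss = (q', as)"
  shows "q' < tm_nstates M" "length as = tm_ntapes M"
    "set as \<subseteq> {..<tm_nsyms M} \<times> {-1, 0, 1}"
  using assms unfolding wf_tm_def by (metis fst_conv snd_conv)+

lemma wf_tm_bounds:
  assumes "wf_tm M"
  shows "tm_ntapes M \<ge> 1" "tm_nsyms M \<ge> 3" "tm_start M < tm_nstates M"
    "tm_accept M < tm_nstates M" "tm_reject M < tm_nstates M" "tm_accept M \<noteq> tm_reject M"
  using assms by (auto simp: wf_tm_def)

lemma wf_seq_tm:
  assumes M: "wf_tm M" and N: "wf_tm N"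
  shows "wf_tm (seq_tm M N)"
proof -
  let ?S = "seq_tm M N"
  note bM = wf_tm_bounds[OF M] and bN = wf_tm_bounds[OF N]
  have "fst (tm_delta ?S q ss) < tm_nstates ?S \<and>
      length (snd (tm_delta ?S q ss)) = tm_ntapes ?S \<and>
      set (snd (tm_delta ?S q ss)) \<subseteq> {..<tm_nsyms ?S} \<times> {-1, 0, 1}"
    if q: "q < tm_nstates ?S" and len: "length ss = tm_ntapes ?S"
      and ss: "set ss \<subseteq> {..<tm_nsyms ?S}" for q ss
  proof -
    let ?inM = "q \<noteq> tm_accept M \<and> q \<noteq> tm_reject M \<and> q < tm_nstates M \<and>
      set (take (tm_ntapes M) ss) \<subseteq> {..<tm_nsyms M}"
    let ?inN = "q \<ge> tm_nstates M \<and> set (drop (tm_ntapes M - 1) ss) \<subseteq> {..<tm_nsyms N}"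
    have stays: "set (stay ss) \<subseteq> {..<tm_nsyms ?S} \<times> {-1, 0, 1}"
      "set (stay (take n ss)) \<subseteq> {..<tm_nsyms ?S} \<times> {-1, 0, 1}"
      "set (stay (drop n ss)) \<subseteq> {..<tm_nsyms ?S} \<times> {-1, 0, 1}" for n
      using ss set_take_subset[of n ss] set_drop_subset[of n ss]
      by (intro set_stay_subset; blast)+
    consider ?inM | ?inN | "\<not> ?inM" "\<not> ?inN" by blast
    then show ?thesis
    proof cases
      case 1
      obtain q' as where d: "tm_delta M q (take (tm_ntapes M) ss) = (q', as)" by fastforce
      have "q' < tm_nstates M" "length as = tm_ntapes M"
        "set as \<subseteq> {..<tm_nsyms M} \<times> {-1, 0, 1}"
        using wf_tmD[OF M _ _ _ d] 1 len by auto
      with 1 d len stays show ?thesis by (auto simp: seq_tm_def)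
    next
      case 2
      obtain q' as where d: "tm_delta N (q - tm_nstates M) (drop (tm_ntapes M - 1) ss) = (q', as)"
        by fastforce
      have "q' < tm_nstates N" "length as = tm_ntapes N"
        "set as \<subseteq> {..<tm_nsyms N} \<times> {-1, 0, 1}"
        using wf_tmD[OF N _ _ _ d] 2 len q bM bN by auto
      with 2 d len stays bM bN show ?thesis by (auto simp: seq_tm_def)
    next
      case 3
      then have "snd (tm_delta ?S q ss) = stay ss"
        "fst (tm_delta ?S q ss) \<in> {tm_nstates M + tm_start N, tm_nstates M + tm_reject N}"
        by (auto simp: seq_tm_def)
      with stays(1) len bN show ?thesis by auto
    qed
  qed
  with bM bN show ?thesis by (auto simp: wf_tm_def)
qed

lemma seq_tm_step_first:
  assumes M: "wf_tm M" and v: "valid_config M (q, ts)" and nh: "\<not> halted M (q, ts)"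
    and step: "tm_step M (q, ts) = (q', ts')"
  shows "tm_step (seq_tm M N) (q, ts @ us) = (q', ts' @ us)"
proof -
  let ?ss = "map (\<lambda>t. t 0) ts"
  obtain p as where d: "tm_delta M q ?ss = (p, as)" by fastforce
  have vv: "q < tm_nstates M" "length ts = tm_ntapes M" "set ?ss \<subseteq> {..<tm_nsyms M}"
    using v by (auto simp: valid_config_def)
  then have "length as = length ts" using wf_tmD[OF M _ _ _ d] by simp
  moreover have "q' = p" "ts' = map2 tape_act as ts"
    using step nh d by (auto simp: tm_step_def halted_def)
  moreover have "tm_delta (seq_tm M N) q (map (\<lambda>t. t 0) (ts @ us)) =
      (p, as @ stay (map (\<lambda>t. t 0) us))"
    using vv nh d by (simp add: seq_tm_def halted_def)
  ultimately show ?thesis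
    using vv by (simp add: tm_step_def)
qed

lemma seq_tm_step_second:
  assumes M: "wf_tm M" and N: "wf_tm N" and v: "valid_config N (q, us)"
    and vs: "length vs = tm_ntapes M - 1"
    and step: "tm_step N (q, us) = (q', us')"
  shows "tm_step (seq_tm M N) (tm_nstates M + q, vs @ us) = (tm_nstates M + q', vs @ us')"
proof (cases "halted N (q, us)")
  case True
  with step tm_step_halted[OF True] show ?thesis
    by (auto simp: tm_step_def halted_def)
next
  case False
  let ?ss = "map (\<lambda>t. t 0) us"
  obtain p as where d: "tm_delta N q ?ss = (p, as)" by fastforce
  have vv: "q < tm_nstates N" "length us = tm_ntapes N" "set ?ss \<subseteq> {..<tm_nsyms N}"
    using v by (auto simp: valid_config_def)
  have "q' = p" "us' = map2 tape_act as us"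
    using step False d by (auto simp: tm_step_def halted_def)
  moreover have "tm_delta (seq_tm M N) (tm_nstates M + q) (map (\<lambda>t. t 0) (vs @ us)) =
      (tm_nstates M + p, stay (map (\<lambda>t. t 0) vs) @ as)"
    using vv vs d wf_tm_bounds[OF M] by (simp add: seq_tm_def)
  ultimately show ?thesis
    using False by (simp add: tm_step_def halted_def)
qed

text \<open>The first machine may halt before its time bound, and then the combined machine moves on
  at once; hence the combined run is only matched at some earlier time \<open>t\<close>.\<close>

lemma seq_tm_run_first:
  assumes M: "wf_tm M" and v: "valid_config M (q, ts)"
    and run: "(tm_step M ^^ n) (q, ts) = (q', ts')"
  shows "\<exists>t\<le>n. (tm_step (seq_tm M N) ^^ t) (q, ts @ us) = (q', ts' @ us)"
  using run
proof (induction n arbitrary: q' ts')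
  case 0
  then show ?case by simp
next
  case (Suc n)
  obtain p rs where c: "(tm_step M ^^ n) (q, ts) = (p, rs)" by fastforce
  with Suc.IH obtain t where
    t: "t \<le> n" "(tm_step (seq_tm M N) ^^ t) (q, ts @ us) = (p, rs @ us)" by blast
  have s: "tm_step M (p, rs) = (q', ts')" using Suc.prems c by simp
  show ?case
  proof (cases "halted M (p, rs)")
    case True
    then have "(q', ts') = (p, rs)" using s tm_step_halted by simp
    with t le_SucI show ?thesis by blast
  next
    case False
    have "valid_config M (p, rs)" using valid_config_run[OF M v, of n] c by simp
    from seq_tm_step_first[OF M this False s] t
    have "(tm_step (seq_tm M N) ^^ Suc t) (q, ts @ us) = (q', ts' @ us)" by simp
    with t(1) show ?thesis by (meson Suc_le_mono)
  qed
qed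

lemma seq_tm_run_second:
  assumes M: "wf_tm M" and N: "wf_tm N" and v: "valid_config N (q, us)"
    and vs: "length vs = tm_ntapes M - 1"
    and run: "(tm_step N ^^ n) (q, us) = (q', us')"
  shows "(tm_step (seq_tm M N) ^^ n) (tm_nstates M + q, vs @ us) = (tm_nstates M + q', vs @ us')"
  using run
proof (induction n arbitrary: q' us')
  case 0
  then show ?case by simp
next
  case (Suc n)
  obtain p rs where c: "(tm_step N ^^ n) (q, us) = (p, rs)" by fastforce
  have "valid_config N (p, rs)" using valid_config_run[OF N v, of n] c by simp
  moreover have "tm_step N (p, rs) = (q', us')" using Suc.prems c by simp
  ultimately show ?case
    using Suc.IH[OF c] seq_tm_step_second[OF M N _ vs] by simp
qed

text \<open>The time bound of the second machine is evaluated at the length of the intermediate word;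
  the bound \<open>B\<close> on that length turns it into a bound in terms of the input.\<close>

lemma tm_computes_seq_tm:
  assumes M: "wf_tm M" and N: "wf_tm N"
    and cM: "tm_computes_in_time M f T" and cN: "tm_computes_in_time N g S"
    and B: "\<And>x y. f x = Some y \<Longrightarrow> S (length y) \<le> B (length x)"
  shows "tm_computes_in_time (seq_tm M N) (g \<circ>\<^sub>m f) (\<lambda>n. T n + 1 + B n)"
  unfolding tm_computes_in_time_def Let_def
proof
  fix x :: word
  let ?S = "seq_tm M N" and ?k = "tm_nstates M"
  let ?blanks = "replicate (tm_ntapes N - 1) (word_tape [])"
  let ?n = "T (length x) + 1 + B (length x)"
  note bM = wf_tm_bounds[OF M] and bN = wf_tm_bounds[OF N]
  obtain q ts where run: "(tm_step M ^^ T (length x)) (tm_init M x) = (q, ts)" by fastforce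
  have res: "case f x of None \<Rightarrow> q = tm_reject M
      | Some y \<Rightarrow> q = tm_accept M \<and> last ts = word_tape y"
    using cM[unfolded tm_computes_in_time_def, rule_format, of x] by (simp add: run)
  have vM: "valid_config M (tm_init M x)" using valid_config_init[OF M] .
  have len: "length ts = tm_ntapes M"
    using valid_config_run[OF M vM, of "T (length x)"] run by (simp add: valid_config_def)
  have init: "tm_init ?S x = (fst (tm_init M x), snd (tm_init M x) @ ?blanks)"
    using bM(1) by (simp add: tm_init_def replicate_add[symmetric])
  obtain t where t: "t \<le> T (length x)" "(tm_step ?S ^^ t) (tm_init ?S x) = (q, ts @ ?blanks)"
    using seq_tm_run_first[OF M, of "fst (tm_init M x)" "snd (tm_init M x)"] vM run
    unfolding init by (metis prod.collapse)
  show "case (tm_step ?S ^^ ?n) (tm_init ?S x) of (q, ts) \<Rightarrow>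
      case (g \<circ>\<^sub>m f) x of None \<Rightarrow> q = tm_reject ?S
      | Some y \<Rightarrow> q = tm_accept ?S \<and> last ts = word_tape y"
  proof (cases "f x")
    case None
    with res have "q = tm_reject M" by simp
    with bM have "tm_step ?S (q, ts @ ?blanks) = (?k + tm_reject N, ts @ ?blanks)"
      by (simp add: tm_step_def seq_tm_def flip: map_append)
    with t(2) have c: "(tm_step ?S ^^ Suc t) (tm_init ?S x) = (?k + tm_reject N, ts @ ?blanks)"
      by simp
    then have "halted ?S ((tm_step ?S ^^ Suc t) (tm_init ?S x))" by (simp add: halted_def)
    from tm_run_after_halting[OF this, of ?n] c t(1) None show ?thesis by simp
  next
    case (Some y)
    with res have q: "q = tm_accept M" and "last ts = word_tape y" by auto
    moreover have "ts \<noteq> []" using len bM by auto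
    ultimately have ts: "ts = butlast ts @ [word_tape y]" by (metis append_butlast_last_id)
    have "tm_step ?S (q, ts @ ?blanks) = (?k + tm_start N, ts @ ?blanks)"
      using q bM by (simp add: tm_step_def seq_tm_def flip: map_append)
    moreover have "ts @ ?blanks = butlast ts @ snd (tm_init N y)"
      by (subst ts) (simp add: tm_init_def)
    ultimately have "tm_step ?S (q, ts @ ?blanks) =
        (?k + fst (tm_init N y), butlast ts @ snd (tm_init N y))"
      by (simp only: tm_init_def fst_conv)
    with t(2) have handover: "(tm_step ?S ^^ Suc t) (tm_init ?S x) =
        (?k + fst (tm_init N y), butlast ts @ snd (tm_init N y))"
      by simp
    obtain p us where runN: "(tm_step N ^^ S (length y)) (tm_init N y) = (p, us)" by fastforce
    have resN: "case g y of None \<Rightarrow> p = tm_reject N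
        | Some z \<Rightarrow> p = tm_accept N \<and> last us = word_tape z"
      using cN[unfolded tm_computes_in_time_def, rule_format, of y] by (simp add: runN)
    have vN: "valid_config N (tm_init N y)" using valid_config_init[OF N] .
    have "length us = tm_ntapes N"
      using valid_config_run[OF N vN, of "S (length y)"] runN by (simp add: valid_config_def)
    then have us: "us \<noteq> []" using bN by auto
    have "(tm_step ?S ^^ S (length y)) ((tm_step ?S ^^ Suc t) (tm_init ?S x)) =
        (?k + p, butlast ts @ us)"
      unfolding handover using vN runN len by (intro seq_tm_run_second[OF M N]) simp_all
    then have c: "(tm_step ?S ^^ (S (length y) + Suc t)) (tm_init ?S x) = (?k + p, butlast ts @ us)"
      by (simp only: funpow_add comp_apply)
    moreover have "halted ?S (?k + p, butlast ts @ us)"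
      using resN by (auto simp: halted_def split: option.splits)
    moreover have "S (length y) + Suc t \<le> ?n" using B[OF Some] t(1) by simp
    ultimately have "(tm_step ?S ^^ ?n) (tm_init ?S x) = (?k + p, butlast ts @ us)"
      using tm_run_after_halting by metis
    with resN us Some show ?thesis by (auto split: option.splits)
  qed
qed

section \<open>Polynomially balanced functions in polynomial time\<close>

lemma poly_nat_mono:
  fixes p :: "nat poly"
  assumes "m \<le> n"
  shows "poly p m \<le> poly p n"
  by (induction p) (auto intro: add_mono mult_mono assms)

lemma poly_balanced_comp:
  assumes "poly_balanced f" "poly_balanced g"
  shows "poly_balanced (g \<circ>\<^sub>m f)"
proof -
  from assms obtain p q :: "nat poly" where
    p: "\<And>x y. f x = Some y \<Longrightarrow> length y \<le> poly p (length x) \<and> length x \<le> poly p (length y)" and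
    q: "\<And>x y. g x = Some y \<Longrightarrow> length y \<le> poly q (length x) \<and> length x \<le> poly q (length y)"
    unfolding poly_balanced_def by blast
  have "length z \<le> poly (q \<circ>\<^sub>p p + p \<circ>\<^sub>p q) (length x) \<and>
      length x \<le> poly (q \<circ>\<^sub>p p + p \<circ>\<^sub>p q) (length z)" if "(g \<circ>\<^sub>m f) x = Some z" for x z
  proof -
    from that obtain y where y: "f x = Some y" "g y = Some z"
      by (auto simp: map_comp_Some_iff)
    have "length z \<le> poly q (poly p (length x))"
      using p[OF y(1)] q[OF y(2)] poly_nat_mono order_trans by blast
    moreover have "length x \<le> poly p (poly q (length z))"
      using p[OF y(1)] q[OF y(2)] poly_nat_mono order_trans by blast
    ultimately show ?thesis by (simp add: poly_pcompose)
  qed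
  then show ?thesis unfolding poly_balanced_def by blast
qed

text \<open>Balancedness of the first function bounds the length of the intermediate word, and hence the
  running time of the second machine, by a polynomial in the length of the input.\<close>

lemma fP_comp:
  assumes "f \<in> fP" "g \<in> fP"
  shows "g \<circ>\<^sub>m f \<in> fP"
proof -
  from assms obtain M N and p q :: "nat poly" where
    M: "wf_tm M" "tm_computes_in_time M f (poly p)" and
    N: "wf_tm N" "tm_computes_in_time N g (poly q)"
    unfolding fP_def polytime_computable_def by blast
  from assms(1) obtain b :: "nat poly" where
    b: "\<And>x y. f x = Some y \<Longrightarrow> length y \<le> poly b (length x)"
    unfolding fP_def poly_balanced_def by blast
  have "tm_computes_in_time (seq_tm M N) (g \<circ>\<^sub>m f)
      (\<lambda>n. poly p n + 1 + poly q (poly b n))"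
    using b by (intro tm_computes_seq_tm[OF M(1) N(1) M(2) N(2)] poly_nat_mono)
  also have "(\<lambda>n. poly p n + 1 + poly q (poly b n)) = poly (p + 1 + q \<circ>\<^sub>p b)"
    by (auto simp: poly_pcompose)
  finally have "polytime_computable (g \<circ>\<^sub>m f)"
    using wf_seq_tm[OF M(1) N(1)] unfolding polytime_computable_def by blast
  with assms poly_balanced_comp show ?thesis by (auto simp: fP_def)
qed

section \<open>Prepending and stripping a prefix\<close>

definition prepend :: "word \<Rightarrow> word \<rightharpoonup> word" where
  "prepend u w = Some (u @ w)"

fun strip :: "word \<Rightarrow> word \<rightharpoonup> word" where
  "strip [] w = Some w"
| "strip (a # u) [] = None"
| "strip (a # u) (b # w) = (if a = b then strip u w else None)"

lemma strip_Some_iff: "strip u w = Some v \<longleftrightarrow> w = u @ v"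
  by (induction u w rule: strip.induct) auto

lemma strip_append [simp]: "strip u (u @ w) = Some w"
  by (simp add: strip_Some_iff)

lemma prepend_Cons: "prepend (a # u) = prepend [a] \<circ>\<^sub>m prepend u"
  by (auto simp: prepend_def map_comp_def)

lemma strip_Cons: "strip (a # u) = strip u \<circ>\<^sub>m strip [a]"
proof
  show "strip (a # u) w = (strip u \<circ>\<^sub>m strip [a]) w" for w
    by (cases w) (simp_all add: map_comp_def)
qed

lemma word_tape_Cons:
  "word_tape (b # w) i = (if i = 0 then (if b then 2 else 1) else word_tape w (i - 1))"
proof -
  have "nat i = Suc (nat (i - 1))" if "i > 0" using that by simp
  then show ?thesis by (auto simp: word_tape_def)
qed

definition id_tm :: tm where
  "id_tm = \<lparr>tm_ntapes = 1, tm_nsyms = 3, tm_nstates = 2, tm_start = 0, tm_accept = 0,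
     tm_reject = 1, tm_delta = (\<lambda>q ss. (0, stay ss))\<rparr>"

definition empty_tm :: tm where
  "empty_tm = \<lparr>tm_ntapes = 1, tm_nsyms = 3, tm_nstates = 2, tm_start = 1, tm_accept = 0,
     tm_reject = 1, tm_delta = (\<lambda>q ss. (0, stay ss))\<rparr>"

text \<open>Tapes are stored relative to their heads, so a move to the left is all it takes to make room for
  a letter at index 0, and a move to the right turns the second letter into the first one.\<close>

definition prepend_tm :: "bool \<Rightarrow> tm" where
  "prepend_tm b = \<lparr>tm_ntapes = 1, tm_nsyms = 3, tm_nstates = 4, tm_start = 0, tm_accept = 2,
     tm_reject = 3, tm_delta = (\<lambda>q ss.
       if q = 0 then (1, map (\<lambda>s. (s, -1)) ss) else (2, [(if b then 2 else 1, 0)]))\<rparr>"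

definition strip_tm :: "bool \<Rightarrow> tm" where
  "strip_tm b = \<lparr>tm_ntapes = 1, tm_nsyms = 3, tm_nstates = 3, tm_start = 0, tm_accept = 1,
     tm_reject = 2, tm_delta = (\<lambda>q ss.
       (if ss = [if b then 2 else 1] then 1 else 2, [(0, 1)]))\<rparr>"

lemma fPI:
  assumes "wf_tm M" "tm_computes_in_time M f (\<lambda>_. k)"
    and "\<And>x y. f x = Some y \<Longrightarrow> length y \<le> length x + 1 \<and> length x \<le> length y + 1"
  shows "f \<in> fP"
proof -
  have "(\<lambda>_. k) = poly [:k:]" by auto
  with assms(1,2) have "polytime_computable f"
    unfolding polytime_computable_def by metis
  moreover have "poly_balanced f"
    unfolding poly_balanced_def using assms(3) by (intro exI[of _ "[:1, 1:]"]) auto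
  ultimately show ?thesis by (simp add: fP_def)
qed

lemma Some_in_fP: "Some \<in> fP"
proof (rule fPI[where M = id_tm and k = 0])
  show "wf_tm id_tm" by (auto simp: wf_tm_def id_tm_def stay_def)
  show "tm_computes_in_time id_tm Some (\<lambda>_. 0)"
    by (simp add: tm_computes_in_time_def tm_init_def id_tm_def)
qed auto

lemma empty_in_fP: "Map.empty \<in> fP"
proof (rule fPI[where M = empty_tm and k = 0])
  show "wf_tm empty_tm" by (auto simp: wf_tm_def empty_tm_def stay_def)
  show "tm_computes_in_time empty_tm Map.empty (\<lambda>_. 0)"
    by (simp add: tm_computes_in_time_def tm_init_def empty_tm_def)
qed auto

lemma prepend_letter_in_fP: "prepend [b] \<in> fP"
proof (rule fPI[where M = "prepend_tm b" and k = 2])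
  show "wf_tm (prepend_tm b)" by (auto simp: wf_tm_def prepend_tm_def)
  have "tape_act (if b then 2 else 1, 0) (tape_act (word_tape x 0, -1) (word_tape x)) =
      word_tape (b # x)" for x
    by (auto simp: tape_act_def word_tape_Cons)
  then show "tm_computes_in_time (prepend_tm b) (prepend [b]) (\<lambda>_. 2)"
    by (simp add: tm_computes_in_time_def tm_init_def prepend_tm_def tm_step_def prepend_def
        numeral_2_eq_2)
qed (auto simp: prepend_def)

lemma strip_letter_in_fP: "strip [b] \<in> fP"
proof (rule fPI[where M = "strip_tm b" and k = 1])
  show "wf_tm (strip_tm b)" by (auto simp: wf_tm_def strip_tm_def)
  have erase: "tape_act (0, 1) (word_tape (a # x)) = word_tape x" for a x
  proof
    have "word_tape x (-1) = 0" by (simp add: word_tape_def)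
    moreover have "i = -1" if "i + 1 = 0" for i :: int using that by simp
    ultimately have "word_tape x i = 0" if "i + 1 = 0" for i using that by metis
    then show "tape_act (0, 1) (word_tape (a # x)) i = word_tape x i" for i
      by (simp add: tape_act_def word_tape_Cons)
  qed
  have "case tm_step (strip_tm b) (tm_init (strip_tm b) x) of (q, ts) \<Rightarrow>
      case strip [b] x of None \<Rightarrow> q = tm_reject (strip_tm b)
      | Some y \<Rightarrow> q = tm_accept (strip_tm b) \<and> last ts = word_tape y" for x
    by (cases x)
      (auto simp: tm_init_def strip_tm_def tm_step_def erase, auto simp: word_tape_def)
  then show "tm_computes_in_time (strip_tm b) (strip [b]) (\<lambda>_. 1)"
    by (simp add: tm_computes_in_time_def)
qed (auto simp: strip_Some_iff)

lemma prepend_in_fP: "prepend u \<in> fP"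
proof (induction u)
  case Nil
  have "prepend [] = Some" by (auto simp: prepend_def)
  with Some_in_fP show ?case by simp
next
  case (Cons a u)
  then show ?case using fP_comp prepend_letter_in_fP prepend_Cons by metis
qed

lemma strip_in_fP: "strip u \<in> fP"
proof (induction u)
  case Nil
  have "strip [] = Some" by auto
  with Some_in_fP show ?case by simp
next
  case (Cons a u)
  then show ?case using fP_comp strip_letter_in_fP strip_Cons by metis
qed

section \<open>The monoid of polynomial right-ideal morphisms\<close>

lemma mult_RMP [simp]: "f \<otimes>\<^bsub>RMP\<^esub> g = f \<circ>\<^sub>m g"
  by (simp add: RMP_def)

lemma one_RMP [simp]: "\<one>\<^bsub>RMP\<^esub> = Some"
  by (simp add: RMP_def)

lemma carrier_RMP: "f \<in> carrier RMP \<longleftrightarrow> f \<in> fP \<and> right_ideal_morphism f"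
  by (simp add: RMP_def)

lemma RMP_comp: "f \<in> carrier RMP \<Longrightarrow> g \<in> carrier RMP \<Longrightarrow> f \<circ>\<^sub>m g \<in> carrier RMP"
  by (simp add: carrier_RMP fP_comp right_ideal_morphism_comp)

lemma Some_in_RMP: "Some \<in> carrier RMP"
  and empty_in_RMP: "Map.empty \<in> carrier RMP"
  and prepend_in_RMP: "prepend u \<in> carrier RMP"
  and strip_in_RMP: "strip u \<in> carrier RMP"
  by (simp_all add: carrier_RMP Some_in_fP empty_in_fP prepend_in_fP strip_in_fP)
    (simp_all add: right_ideal_morphism_iff prepend_def strip_Some_iff)

lemma map_comp_assoc: "(f \<circ>\<^sub>m g) \<circ>\<^sub>m h = f \<circ>\<^sub>m (g \<circ>\<^sub>m h)"
  by (auto simp: map_comp_def split: option.splits)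

lemma map_comp_Some_left: "Some \<circ>\<^sub>m f = f"
  and map_comp_Some_right: "f \<circ>\<^sub>m Some = f"
  by (auto simp: map_comp_def split: option.splits)

lemma monoid_RMP: "monoid RMP"
  by (rule monoidI)
    (simp_all add: RMP_comp Some_in_RMP map_comp_assoc map_comp_Some_left map_comp_Some_right)

lemma monoid_congruence_RMP_end_rel: "monoid_congruence RMP RMP_end_rel"
  unfolding monoid_congruence_def
proof (intro conjI allI impI)
  show "equiv (carrier RMP) RMP_end_rel"
  proof (rule equivI)
    show "trans RMP_end_rel"
      by (rule transI) (auto simp: RMP_end_rel_def carrier_RMP intro: fun_end_equiv_trans)
  qed (auto simp: RMP_end_rel_def refl_on_def sym_def fun_end_equiv_refl fun_end_equiv_sym)
  show "(a \<otimes>\<^bsub>RMP\<^esub> c, b \<otimes>\<^bsub>RMP\<^esub> d) \<in> RMP_end_rel"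
    if "(a, b) \<in> RMP_end_rel \<and> (c, d) \<in> RMP_end_rel" for a b c d
    using that RMP_comp fun_end_equiv_comp
    by (auto simp: RMP_end_rel_def carrier_RMP)
qed

section \<open>Congruences that relate inequivalent morphisms\<close>

lemma morphism_comp_prepend:
  assumes "right_ideal_morphism f" "f x = Some y"
  shows "f \<circ>\<^sub>m prepend x = prepend y"
  using right_ideal_morphism_append[OF assms] by (auto simp: prepend_def)

lemma strip_comp_prepend: "strip u \<circ>\<^sub>m prepend (u @ v) = prepend v"
  by (auto simp: prepend_def)

lemma strip_comp_prepend_incomparable:
  assumes "\<nexists>v. z = y @ v" "\<nexists>v. y = z @ v"
  shows "strip y \<circ>\<^sub>m prepend z = Map.empty"
proof
  fix w
  have "z @ w \<noteq> y @ v" for v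
    using assms by (auto simp: append_eq_append_conv2)
  then show "(strip y \<circ>\<^sub>m prepend z) w = None"
    using strip_Some_iff[of y "z @ w"] by (cases "strip y (z @ w)") (auto simp: prepend_def)
qed

lemma prepend_Nil: "prepend [] = Some"
  by (auto simp: prepend_def)

locale RMP_congruence =
  fixes s :: "((word \<rightharpoonup> word) \<times> (word \<rightharpoonup> word)) set"
  assumes congruence: "monoid_congruence RMP s"
begin

lemma
  equiv_s: "equiv (carrier RMP) s" and
  comp_s: "\<And>a b c d. (a, b) \<in> s \<Longrightarrow> (c, d) \<in> s \<Longrightarrow> (a \<circ>\<^sub>m c, b \<circ>\<^sub>m d) \<in> s"
  using congruence unfolding monoid_congruence_def by auto

lemma refl_s: "f \<in> carrier RMP \<Longrightarrow> (f, f) \<in> s"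
  and sym_s: "(f, g) \<in> s \<Longrightarrow> (g, f) \<in> s"
  and trans_s: "(f, g) \<in> s \<Longrightarrow> (g, h) \<in> s \<Longrightarrow> (f, h) \<in> s"
  and sub_s: "(f, g) \<in> s \<Longrightarrow> f \<in> carrier RMP \<and> g \<in> carrier RMP"
  using equiv_s by (auto simp: equiv_def refl_on_def sym_def intro: transD)

lemma comp_prepend_s: "(f, g) \<in> s \<Longrightarrow> (f \<circ>\<^sub>m prepend x, g \<circ>\<^sub>m prepend x) \<in> s"
  using comp_s refl_s prepend_in_RMP by blast

lemma strip_comp_s: "(f, g) \<in> s \<Longrightarrow> (strip y \<circ>\<^sub>m f, strip y \<circ>\<^sub>m g) \<in> s"
  using comp_s refl_s strip_in_RMP by blast

lemma universal_if_one_rel_zero: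
  assumes "(Some, Map.empty) \<in> s"
  shows "s = carrier RMP \<times> carrier RMP"
proof -
  have "(f, Map.empty) \<in> s" if "f \<in> carrier RMP" for f
    using comp_s[OF refl_s[OF that] assms] by (simp add: map_comp_Some_right)
  with sub_s sym_s trans_s show ?thesis by fast
qed

lemma universal_if_prepend_rel_zero:
  assumes "(prepend y, Map.empty) \<in> s"
  shows "s = carrier RMP \<times> carrier RMP"
proof (rule universal_if_one_rel_zero)
  have "strip y \<circ>\<^sub>m Map.empty = Map.empty" by auto
  with strip_comp_s[OF assms, of y] show "(Some, Map.empty) \<in> s"
    using strip_comp_prepend[of y "[]"] by (simp add: prepend_Nil)
qed

text \<open>Stripping a letter \<open>b\<close> other than the first one of \<open>v\<close> empties \<open>prepend v\<close>, also after \<open>b\<close> has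
  been prepended, whereas prepending and stripping \<open>b\<close> leaves the identity as it is.\<close>

lemma universal_if_one_rel_prepend:
  assumes "(Some, prepend v) \<in> s" "v \<noteq> []"
  shows "s = carrier RMP \<times> carrier RMP"
proof (rule universal_if_one_rel_zero)
  obtain a u where v: "v = a # u" using assms(2) by (cases v) auto
  let ?b = "[\<not> a]"
  have "strip ?b \<circ>\<^sub>m (prepend v \<circ>\<^sub>m prepend ?b) = Map.empty"
    by (auto simp: v prepend_def)
  moreover have "strip ?b \<circ>\<^sub>m (Some \<circ>\<^sub>m prepend ?b) = Some"
    using strip_comp_prepend[of ?b "[]"] by (simp add: map_comp_Some_left prepend_Nil)
  ultimately show "(Some, Map.empty) \<in> s"
    using strip_comp_s[OF comp_prepend_s[OF assms(1), of ?b], of ?b] by simp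
qed

lemma universal_if_prepend_rel_prepend_append:
  assumes "(prepend y, prepend (y @ v)) \<in> s" "v \<noteq> []"
  shows "s = carrier RMP \<times> carrier RMP"
  using strip_comp_s[OF assms(1), of y] strip_comp_prepend[of y "[]"]
  by (intro universal_if_one_rel_prepend[OF _ assms(2)]) (simp add: strip_comp_prepend prepend_Nil)

lemma universal_if_prepend_rel_prepend:
  assumes yz: "(prepend y, prepend z) \<in> s" and "y \<noteq> z"
  shows "s = carrier RMP \<times> carrier RMP"
proof -
  consider v where "z = y @ v" | v where "y = z @ v" | "\<nexists>v. z = y @ v" "\<nexists>v. y = z @ v"
    by blast
  then show ?thesis
  proof cases
    case 1
    with assms show ?thesis using universal_if_prepend_rel_prepend_append[of y v] by auto
  next
    case 2
    with assms sym_s show ?thesis using universal_if_prepend_rel_prepend_append[of z v] by auto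
  next
    case 3
    from strip_comp_s[OF yz, of y] have "(Some, Map.empty) \<in> s"
      using strip_comp_prepend[of y "[]"] strip_comp_prepend_incomparable[OF 3]
      by (simp add: prepend_Nil)
    then show ?thesis by (rule universal_if_one_rel_zero)
  qed
qed

lemma universal_if_no_common_extension:
  assumes fg: "(f, g) \<in> s" and x: "f x = Some y" and none: "\<And>w. g (x @ w) = None"
  shows "s = carrier RMP \<times> carrier RMP"
proof -
  have "right_ideal_morphism f" using sub_s[OF fg] by (simp add: carrier_RMP)
  then have "f \<circ>\<^sub>m prepend x = prepend y" using x by (rule morphism_comp_prepend)
  moreover have "g \<circ>\<^sub>m prepend x = Map.empty" using none by (auto simp: prepend_def)
  ultimately show ?thesis
    using comp_prepend_s[OF fg, of x] universal_if_prepend_rel_zero by simp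
qed

lemma universal_if_disagree:
  assumes fg: "(f, g) \<in> s" and "f x = Some y" "g x = Some z" "y \<noteq> z"
  shows "s = carrier RMP \<times> carrier RMP"
proof (rule universal_if_prepend_rel_prepend)
  show "(prepend y, prepend z) \<in> s"
    using comp_prepend_s[OF fg, of x] sub_s[OF fg] assms(2,3)
    by (simp add: carrier_RMP morphism_comp_prepend)
qed fact

lemma universal_if_not_end_equiv:
  assumes fg: "(f, g) \<in> s" and ne: "\<not> fun_end_equiv f g"
  shows "s = carrier RMP \<times> carrier RMP"
proof -
  have ideals: "right_ideal (dom f)" "right_ideal (dom g)"
    using sub_s[OF fg] by (auto simp: carrier_RMP right_ideal_morphism_def)
  consider x where "x \<in> dom f" "\<And>w. x @ w \<notin> dom g" | x where "x \<in> dom g" "\<And>w. x @ w \<notin> dom f"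
    | x where "x \<in> dom f" "x \<in> dom g" "f x \<noteq> g x"
    using ne unfolding fun_end_equiv_def end_equiv_iff[OF ideals] by blast
  then show ?thesis
  proof cases
    case 1
    then show ?thesis using universal_if_no_common_extension[OF fg] by (auto simp: domIff)
  next
    case 2
    then show ?thesis using universal_if_no_common_extension[OF sym_s[OF fg]] by (auto simp: domIff)
  next
    case 3
    then show ?thesis using universal_if_disagree[OF fg] by auto
  qed
qed

end

theorem theorem2p24:
  shows "congruence_simple M_end_P"
  unfolding M_end_P_def
proof (rule congruence_simple_quotient_monoid)
  show "monoid RMP" by (rule monoid_RMP)
  show "monoid_congruence RMP RMP_end_rel" by (rule monoid_congruence_RMP_end_rel)
  show "Map.empty \<in> carrier RMP" by (rule empty_in_RMP)
  have "\<not> fun_end_equiv Map.empty Some"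
    using Some_in_RMP empty_in_RMP by (subst fun_end_equiv_iff) (auto simp: carrier_RMP)
  then show "(Map.empty, \<one>\<^bsub>RMP\<^esub>) \<notin> RMP_end_rel"
    by (simp add: RMP_end_rel_def)
next
  fix s
  assume s: "monoid_congruence RMP s" and "RMP_end_rel \<subseteq> s" "s \<noteq> RMP_end_rel"
  interpret RMP_congruence s by standard (rule s)
  from \<open>RMP_end_rel \<subseteq> s\<close> \<open>s \<noteq> RMP_end_rel\<close> obtain f g where "(f, g) \<in> s" "(f, g) \<notin> RMP_end_rel"
    by auto
  with sub_s have "\<not> fun_end_equiv f g" by (auto simp: RMP_end_rel_def)
  with \<open>(f, g) \<in> s\<close> show "s = carrier RMP \<times> carrier RMP"
    by (rule universal_if_not_end_equiv)
qed

end
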